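(* Let $t>0$, let $n\ge0$ be an integer and let $x\in(0,1]$. For $0<\epsilon<\frac x\alpha$, $$\left|\partial_x^{n+1}u_t(x)\right|\le(2\pi)^{1/4}\|W\|\left\{\left(\frac{\sqrt2}{x-\alpha\epsilon}\right)^{n+1}+\frac1x\left(\frac{\sqrt2}{x-\alpha\epsilon}\right)^n\right\}(n+1)!+\|W\|\left\{\left(\frac1{\sigma_t\sqrt\epsilon}\right)^{n+1}+\frac{n+1}x\left(\frac1{\sigma_t\sqrt\epsilon}\right)^n\right\}\sqrt{(n+1)!},$$ where $\|W\|=\sup_{0\le s\le1}|W(s)|$.
   Context: Fix $\alpha\in(0,1)$, $\sigma=\sqrt{\alpha(1-\alpha)}$ and $\sigma_t=\sigma/\sqrt t$. Let $W$ be a standard one-dimensional Brownian motion on $[0,1]$ (with continuous paths, $W(0)=0$). The scaled one-dimensional Conga line at time $t$ is $$u_t(x)=\int_0^1W(1-z)\frac{1}{\sqrt{2\pi}}\,\frac{x+\alpha z}{2\sigma_t z^{3/2}}\exp\left(-\frac{(x-\alpha z)^2}{2\sigma_t^2z}\right)dz,\qquad 0<x\le 1 .$$ *)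

theory Defs
  imports "HOL-Probability.Probability"
begin

text \<open>Every path, and not only almost every path, is continuous and starts at 0.\<close>

locale standard_brownian_motion_01 = prob_space M for M :: "'a measure" +
  fixes W :: "real \<Rightarrow> 'a \<Rightarrow> real"
  assumes start: "\<And>\<omega>. \<omega> \<in> space M \<Longrightarrow> W 0 \<omega> = 0"
    and continuous_paths: "\<And>\<omega>. \<omega> \<in> space M \<Longrightarrow> continuous_on {0..1} (\<lambda>s. W s \<omega>)"
    and gaussian_increments: "\<And>r s. 0 \<le> r \<Longrightarrow> r < s \<Longrightarrow> s \<le> 1 \<Longrightarrow>
      distributed M lborel (\<lambda>\<omega>. W s \<omega> - W r \<omega>) (normal_density 0 (sqrt (s - r)))"
    and independent_increments: "\<And>(\<tau> :: nat \<Rightarrow> real) k.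
      mono_on {..k} \<tau> \<Longrightarrow> \<tau> ` {..k} \<subseteq> {0..1} \<Longrightarrow>
      indep_vars (\<lambda>_. borel) (\<lambda>i \<omega>. W (\<tau> (Suc i)) \<omega> - W (\<tau> i) \<omega>) {..<k}"

definition conga_sigma :: "real \<Rightarrow> real \<Rightarrow> real" where
  "conga_sigma \<alpha> t = sqrt (\<alpha> * (1 - \<alpha>)) / sqrt t"

text \<open>The scaled Conga line driven by a path \<open>w\<close>. The integrand is bounded near \<open>z = 0\<close> for
  \<open>x > 0\<close>; the formula is meaningful for every \<open>x > 0\<close>, so derivatives at \<open>x = 1\<close> can be
  taken two-sidedly.\<close>

definition conga_line :: "real \<Rightarrow> real \<Rightarrow> (real \<Rightarrow> real) \<Rightarrow> real \<Rightarrow> real" where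
  "conga_line \<alpha> t w x =
    (LBINT z:{0..1}. w (1 - z) * (1 / sqrt (2 * pi)) *
       ((x + \<alpha> * z) / (2 * conga_sigma \<alpha> t * z powr (3/2))) *
       exp (- ((x - \<alpha> * z)\<^sup>2 / (2 * (conga_sigma \<alpha> t)\<^sup>2 * z))))"

definition path_norm :: "(real \<Rightarrow> real) \<Rightarrow> real" where
  "path_norm w = (SUP s\<in>{0..1}. \<bar>w s\<bar>)"

end

theory Submission
  imports Defs
begin

text \<open>Write \<open>s = \<sigma>\<^sub>t\<close>, \<open>\<phi>\<close> for the standard normal density, and \<open>y(x, z) = (x - \<alpha> z) / (s \<surd>z)\<close>. The
  exponential in the Conga line is \<open>exp (- y\<^sup>2 / 2)\<close>, and the factor next to it is
  \<open>- \<partial>y/\<partial>z = (x + \<alpha> z) / (2 s z\<^sup>3\<^sup>/\<^sup>2)\<close>. So, apart from the weight \<open>W (1 - z)\<close>, the integral over \<open>z\<close>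
  is an integral of \<open>\<phi>\<close> over \<open>y\<close>, and estimates of \<open>x\<close>-derivatives become Gaussian means.

  Each differentiation in \<open>x\<close> turns a Hermite polynomial times \<open>\<phi>\<close> into the next one and
  produces a factor \<open>- 1 / (s \<surd>z)\<close>, because \<open>y\<close> is affine in \<open>x\<close>. With \<open>m = n + 1\<close>, the \<open>m\<close>-th
  derivative of the integrand is, up to the sign \<open>(-1)\<^sup>m\<close> and the factor \<open>W (1 - z)\<close>,
  \<open>\<bar>\<partial>y/\<partial>z\<bar> (s \<surd>z)\<^sup>-\<^sup>m He\<^sub>m(y) \<phi>(y) - m (s \<surd>z)\<^sup>-\<^sup>n He\<^sub>n(y) \<phi>(y) / (2 s z\<^sup>3\<^sup>/\<^sup>2)\<close>,
  and \<open>1 / (2 s z\<^sup>3\<^sup>/\<^sup>2) \<le> \<bar>\<partial>y/\<partial>z\<bar> / x\<close> (lemma \<open>kernel_majorant\<close>).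

  The singular factor \<open>1 / (s \<surd>z)\<close> is controlled in two regimes. If \<open>z > \<epsilon>\<close>, it is at most
  \<open>1 / (s \<surd>\<epsilon>)\<close>. If \<open>z \<le> \<epsilon>\<close>, it equals \<open>y / (x - \<alpha> z) \<le> y / (x - \<alpha> \<epsilon>)\<close>, so it is absorbed into a
  power of \<open>y\<close> (lemma \<open>inverse_scale_power_le\<close>). After the change of variables to \<open>y\<close> only the
  means of \<open>\<bar>He\<^sub>k\<bar>\<close> and \<open>\<bar>y\<^sup>k He\<^sub>k\<bar>\<close> remain. Since \<open>He\<^sub>k\<^sup>2\<close> has mean \<open>k!\<close> and \<open>y\<^sup>2\<^sup>k\<close> has mean
  \<open>(2k)! / (2\<^sup>k k!)\<close>, they are at most \<open>\<surd>(k!)\<close> and \<open>\<surd>2\<^sup>k k!\<close> by the Cauchy-Schwarz inequality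
  (lemmas \<open>normal_mean_abs_hermite_le\<close> and \<open>normal_mean_abs_power_hermite_le\<close>).

  Differentiation under the integral is legitimate because every kernel that occurs is jointly
  continuous in \<open>x > 0\<close> and \<open>0 \<le> z \<le> 1\<close>: as \<open>z\<close> tends to 0, \<open>y\<close> tends to infinity and \<open>\<phi>(y)\<close>
  defeats all negative powers of \<open>z\<close>.\<close>

section \<open>Gaussian means of Hermite polynomials\<close>

definition normal_mean :: "real poly \<Rightarrow> real" where
  "normal_mean p = (LBINT y. std_normal_density y * poly p y)"

lemma integrable_normal_poly: "integrable lborel (\<lambda>y. std_normal_density y * poly p y)"
proof -
  have "integrable lborel (\<lambda>y. \<Sum>i\<le>degree p. coeff p i * (std_normal_density y * y ^ i))"
    by (intro Bochner_Integration.integrable_sum integrable_mult_right integrable_std_normal_moment)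
  then show ?thesis
    by (simp add: poly_altdef sum_distrib_left mult.left_commute)
qed

lemma normal_mean_add: "normal_mean (p + q) = normal_mean p + normal_mean q"
  unfolding normal_mean_def
  by (simp add: distrib_left Bochner_Integration.integral_add[OF integrable_normal_poly integrable_normal_poly])

lemma normal_mean_diff: "normal_mean (p - q) = normal_mean p - normal_mean q"
  unfolding normal_mean_def
  by (simp add: right_diff_distrib Bochner_Integration.integral_diff[OF integrable_normal_poly integrable_normal_poly])

lemma normal_mean_smult: "normal_mean (smult c p) = c * normal_mean p"
  unfolding normal_mean_def by (simp add: mult.left_commute)

lemma normal_mean_monom_even: "normal_mean (monom 1 (2 * k)) = fact (2 * k) / (2 ^ k * fact k)"
  unfolding normal_mean_def using integral_std_normal_moment_even[of k] by (simp add: poly_monom)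

lemma normal_mean_monom_odd: "normal_mean (monom 1 (2 * k + 1)) = 0"
  unfolding normal_mean_def using integral_std_normal_moment_odd[of k] by (simp add: poly_monom)

text \<open>For odd \<open>n\<close> this is the moment recursion \<open>(2k + 1)!! = (2k + 1) (2k - 1)!!\<close>; for even \<open>n\<close> both
  sides are odd moments and vanish.\<close>

lemma normal_mean_stein_monom:
  "normal_mean (pderiv (monom 1 n)) = normal_mean ([:0, 1:] * monom 1 n)"
proof -
  have d: "pderiv (monom (1::real) n) = smult (real n) (monom 1 (n - 1))"
    by (simp add: pderiv_monom smult_monom)
  have X: "[:0, 1:] * monom (1::real) n = monom 1 (Suc n)"
    by (simp add: monom_Suc)
  show ?thesis
  proof (cases "even n")
    case True
    then obtain k where k: "n = 2 * k" by (elim evenE)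
    show ?thesis
    proof (cases k)
      case 0
      then show ?thesis unfolding d X normal_mean_smult using normal_mean_monom_odd[of 0] k by simp
    next
      case (Suc j)
      then show ?thesis unfolding d X normal_mean_smult
        using normal_mean_monom_odd[of k] normal_mean_monom_odd[of j] k by simp
    qed
  next
    case False
    then obtain k where k: "n = 2 * k + 1" by (elim oddE)
    have "fact (2 * Suc k) / (2 ^ Suc k * fact (Suc k))
        = real n * (fact (2 * k) / (2 ^ k * fact k))"
    proof -
      have "fact (2 * Suc k) = (2 * (real k + 1)) * (real n * fact (2 * k))"
        by (simp add: k algebra_simps)
      moreover have "2 ^ Suc k * fact (Suc k) = (2 * (real k + 1)) * (2 ^ k * fact k)"
        by simp
      ultimately show ?thesis
        by (simp only: mult_divide_mult_cancel_left_if times_divide_eq_right) simp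
    qed
    then show ?thesis unfolding d X normal_mean_smult
      using normal_mean_monom_even[of k] normal_mean_monom_even[of "Suc k"] k by simp
  qed
qed

text \<open>Stein's identity, that is, integration by parts against \<open>\<phi>' = - y \<phi>\<close>. It follows from the case of
  monomials by linearity.\<close>

lemma normal_mean_stein: "normal_mean (pderiv p) = normal_mean ([:0, 1:] * p)"
proof -
  \<comment> \<open>The monomial factor makes the claim additive along \<open>a + X p\<close>, which the bare identity is not.\<close>
  have "normal_mean (pderiv (monom 1 n * p)) = normal_mean ([:0, 1:] * (monom 1 n * p))" for n
  proof (induction p arbitrary: n)
    case 0
    show ?case by simp
  next
    case (pCons a p)
    have split: "monom 1 n * pCons a p = smult a (monom 1 n) + monom 1 (Suc n) * p"
      by (simp add: monom_Suc)
    show ?case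
      unfolding split
      by (simp only: pderiv_add pderiv_smult distrib_left mult_smult_right normal_mean_add
          normal_mean_smult normal_mean_stein_monom pCons.IH)
  qed
  from this[of 0] show ?thesis by simp
qed

text \<open>By Stein's identity, this is the adjoint of differentiation with respect to the standard normal
  law. It also describes \<open>(p \<phi>)' = - (normal_adjoint p) \<phi>\<close>, so its iterates on 1, the probabilists'
  Hermite polynomials, give all derivatives of \<open>\<phi>\<close>.\<close>

definition normal_adjoint :: "real poly \<Rightarrow> real poly" where
  "normal_adjoint p = [:0, 1:] * p - pderiv p"

primrec hermite :: "nat \<Rightarrow> real poly" where
  "hermite 0 = 1"
| "hermite (Suc m) = normal_adjoint (hermite m)"

lemma normal_adjoint_smult: "normal_adjoint (smult c p) = smult c (normal_adjoint p)"
  by (simp add: normal_adjoint_def pderiv_smult smult_diff_right)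

text \<open>The commutation relation of the annihilation and creation operators; it gives
  \<open>He\<^sub>m' = m He\<^sub>m\<^sub>-\<^sub>1\<close>.\<close>

lemma pderiv_normal_adjoint: "pderiv (normal_adjoint p) = p + normal_adjoint (pderiv p)"
  by (simp add: normal_adjoint_def pderiv_diff pderiv_mult pderiv_pCons algebra_simps)

lemma pderiv_hermite: "pderiv (hermite (Suc m)) = smult (real (Suc m)) (hermite m)"
proof (induction m)
  case 0
  show ?case by (simp add: normal_adjoint_def pderiv_pCons one_pCons)
next
  case (Suc m)
  have "pderiv (hermite (Suc (Suc m))) = hermite (Suc m) + normal_adjoint (pderiv (hermite (Suc m)))"
    by (simp only: hermite.simps(2)[of "Suc m"] pderiv_normal_adjoint)
  also have "\<dots> = smult (real (Suc (Suc m))) (hermite (Suc m))"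
    unfolding Suc normal_adjoint_smult hermite.simps(2)[symmetric]
    by (metis of_nat_Suc smult_1_left smult_add_left)
  finally show ?case .
qed

lemma normal_mean_mult_normal_adjoint: "normal_mean (p * normal_adjoint q) = normal_mean (pderiv p * q)"
proof -
  have "normal_mean (p * normal_adjoint q) = normal_mean ([:0, 1:] * (p * q)) - normal_mean (p * pderiv q)"
    by (simp only: normal_adjoint_def right_diff_distrib normal_mean_diff mult.left_commute)
  also have "normal_mean ([:0, 1:] * (p * q)) = normal_mean (p * pderiv q) + normal_mean (pderiv p * q)"
    unfolding normal_mean_stein[symmetric] pderiv_mult normal_mean_add by (simp add: mult.commute)
  finally show ?thesis by simp
qed

text \<open>Moving one creation operator to the other factor turns it into a derivative, which lowers the
  degree and yields the factor \<open>m + 1\<close>.\<close>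

lemma normal_mean_hermite_square: "normal_mean (hermite m * hermite m) = fact m"
proof (induction m)
  case 0
  show ?case using normal_mean_monom_even[of 0] by (simp add: monom_0 one_pCons)
next
  case (Suc m)
  have "normal_mean (hermite (Suc m) * hermite (Suc m))
      = normal_mean (pderiv (hermite (Suc m)) * hermite m)"
    using normal_mean_mult_normal_adjoint[of "hermite (Suc m)" "hermite m"] by simp
  also have "\<dots> = real (Suc m) * normal_mean (hermite m * hermite m)"
    by (simp only: pderiv_hermite mult_smult_left normal_mean_smult)
  finally show ?case using Suc by simp
qed

lemma integrable_normal_abs_poly:
  "integrable lborel (\<lambda>y. std_normal_density y * \<bar>poly p y\<bar>)"
  using integrable_abs[OF integrable_normal_poly[of p]] by (simp add: abs_mult)

text \<open>The Cauchy-Schwarz inequality for the standard normal law. For nonzero second moments it is the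
  integrated form of the arithmetic-geometric mean inequality, with weights that balance both
  terms.\<close>

lemma normal_mean_abs_mult_le:
  assumes "0 < a" "0 < b" and p: "normal_mean (p * p) = a\<^sup>2" and q: "normal_mean (q * q) = b\<^sup>2"
  shows "(LBINT y. std_normal_density y * \<bar>poly (p * q) y\<bar>) \<le> a * b"
proof -
  let ?r = "smult (b / a / 2) (p * p) + smult (a / b / 2) (q * q)"
  have le: "\<bar>poly (p * q) y\<bar> \<le> poly ?r y" for y
  proof -
    let ?u = "poly p y" and ?v = "poly q y"
    have "0 \<le> (b * \<bar>?u\<bar> - a * \<bar>?v\<bar>)\<^sup>2" by simp
    also have "\<dots> = b\<^sup>2 * ?u\<^sup>2 + a\<^sup>2 * ?v\<^sup>2 - 2 * (a * b) * \<bar>?u * ?v\<bar>"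
      by (simp add: power2_diff power_mult_distrib abs_mult algebra_simps)
    finally show ?thesis
      using assms(1,2) by (simp add: field_simps power2_eq_square abs_mult)
  qed
  have "(LBINT y. std_normal_density y * \<bar>poly (p * q) y\<bar>) \<le> normal_mean ?r"
    unfolding normal_mean_def
    by (intro integral_mono integrable_normal_abs_poly integrable_normal_poly mult_left_mono le)
      simp
  also have "\<dots> = a * b"
    using assms(1,2) by (simp add: normal_mean_add normal_mean_smult p q power2_eq_square field_simps)
  finally show ?thesis .
qed

text \<open>The central binomial coefficient is at most \<open>2\<^sup>2\<^sup>m\<close>.\<close>
lemma fact_double_le: "fact (2 * m) \<le> (4 ^ m * (fact m)\<^sup>2 :: real)"
proof -
  have "fact (2 * m) = fact m * fact m * ((2 * m) choose m)"
    using binomial_fact_lemma[of m "2 * m"] by (simp add: mult_2)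
  then have "real (fact (2 * m)) = (fact m)\<^sup>2 * real ((2 * m) choose m)"
    by (metis of_nat_mult of_nat_fact power2_eq_square)
  moreover have "real ((2 * m) choose m) \<le> 4 ^ m"
    using binomial_le_pow2[of "2 * m" m]
    by (metis numeral_power_eq_of_nat_cancel_iff of_nat_le_iff power_mult power2_eq_square mult_2
        numeral_Bit0)
  ultimately show ?thesis by (simp add: mult.commute mult_left_mono)
qed

lemma normal_mean_abs_hermite_le:
  "(LBINT y. std_normal_density y * \<bar>poly (hermite m) y\<bar>) \<le> sqrt (fact m)"
  using normal_mean_abs_mult_le[of 1 "sqrt (fact m)" 1 "hermite m"]
    normal_mean_hermite_square[of m] normal_mean_hermite_square[of 0] by simp

lemma normal_mean_abs_power_hermite_le:
  "(LBINT y. std_normal_density y * (\<bar>y\<bar> ^ m * \<bar>poly (hermite m) y\<bar>)) \<le> sqrt 2 ^ m * fact m"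
proof -
  let ?A = "fact (2 * m) / (2 ^ m * fact m) :: real"
  have sq: "monom (1::real) m * monom 1 m = monom 1 (2 * m)"
    by (simp add: mult_monom mult_2)
  have "(LBINT y. std_normal_density y * \<bar>poly (monom 1 m * hermite m) y\<bar>)
      \<le> sqrt ?A * sqrt (fact m)"
    by (rule normal_mean_abs_mult_le)
      (simp_all add: sq normal_mean_monom_even normal_mean_hermite_square real_sqrt_pow2)
  also have "\<dots> = sqrt (fact (2 * m) / 2 ^ m)"
    by (simp add: real_sqrt_mult[symmetric])
  also have "\<dots> \<le> sqrt (2 ^ m * (fact m)\<^sup>2)"
    using fact_double_le[of m] power_mult_distrib[of "2::real" 2 m]
    by (simp add: field_simps)
  also have "\<dots> = sqrt 2 ^ m * fact m"
    by (simp add: real_sqrt_mult real_sqrt_power)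
  finally show ?thesis by (simp add: poly_monom abs_mult power_abs)
qed

section \<open>Polynomials times the normal density\<close>

text \<open>Keep one term of the exponential series.\<close>
lemma power_le_fact_exp:
  assumes "0 \<le> (y::real)"
  shows "y ^ k \<le> fact k * exp y"
proof -
  have "(\<Sum>n\<in>{k}. y ^ n /\<^sub>R fact n) \<le> (\<Sum>n. y ^ n /\<^sub>R fact n)"
    using assms by (intro sum_le_suminf sums_summable[OF exp_converges]) auto
  then show ?thesis
    unfolding sums_unique[OF exp_converges, symmetric] by (simp add: field_simps)
qed

text \<open>The density dominates every polynomial. This decay makes the kernels below vanish at \<open>z = 0\<close>. The
  free exponent \<open>k\<close> carries the induction over the coefficients of \<open>p\<close>.\<close>

lemma normal_power_poly_bounded:
  "\<exists>C. \<forall>y. \<bar>y\<bar> ^ k * \<bar>poly p y\<bar> * std_normal_density y \<le> C"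
proof (induction p arbitrary: k)
  case 0
  show ?case by (intro exI[of _ 0]) simp
next
  case (pCons a p)
  have pow: "\<bar>y\<bar> ^ k * std_normal_density y \<le> fact k * exp (1/2) / sqrt (2 * pi)" for y
  proof -
    have "0 \<le> (\<bar>y\<bar> - 1)\<^sup>2" by simp
    then have "\<bar>y\<bar> + (- y\<^sup>2 / 2) \<le> 1/2"
      by (simp add: power2_eq_square algebra_simps)
    have "\<bar>y\<bar> ^ k * exp (- y\<^sup>2 / 2) \<le> (fact k * exp \<bar>y\<bar>) * exp (- y\<^sup>2 / 2)"
      by (intro mult_right_mono power_le_fact_exp) auto
    also have "\<dots> = fact k * exp (\<bar>y\<bar> + (- y\<^sup>2 / 2))"
      by (simp only: exp_add mult.assoc)
    also have "\<dots> \<le> fact k * exp (1/2)"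
      using \<open>\<bar>y\<bar> + (- y\<^sup>2 / 2) \<le> 1/2\<close> by simp
    finally show ?thesis
      by (simp add: std_normal_density_def divide_right_mono)
  qed
  obtain C where C: "\<And>y. \<bar>y\<bar> ^ Suc k * \<bar>poly p y\<bar> * std_normal_density y \<le> C"
    using pCons.IH[of "Suc k"] by blast
  show ?case
  proof (intro exI allI)
    fix y
    have "\<bar>y\<bar> ^ k * \<bar>poly (pCons a p) y\<bar> * std_normal_density y
        \<le> \<bar>y\<bar> ^ k * (\<bar>a\<bar> + \<bar>y\<bar> * \<bar>poly p y\<bar>) * std_normal_density y"
      by (intro mult_right_mono mult_left_mono) (auto simp: abs_mult[symmetric])
    also have "\<dots> = \<bar>a\<bar> * (\<bar>y\<bar> ^ k * std_normal_density y)
        + \<bar>y\<bar> ^ Suc k * \<bar>poly p y\<bar> * std_normal_density y"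
      by (simp add: algebra_simps)
    also have "\<dots> \<le> \<bar>a\<bar> * (fact k * exp (1/2) / sqrt (2 * pi)) + C"
      by (intro add_mono mult_left_mono pow C) simp
    finally show "\<bar>y\<bar> ^ k * \<bar>poly (pCons a p) y\<bar> * std_normal_density y
        \<le> \<bar>a\<bar> * (fact k * exp (1/2) / sqrt (2 * pi)) + C" .
  qed
qed

lemma std_normal_density_has_derivative:
  "(std_normal_density has_real_derivative - y * std_normal_density y) (at y)"
  unfolding std_normal_density_def[abs_def]
  by (auto intro!: derivative_eq_intros simp: field_simps)

lemma normal_poly_has_derivative:
  "((\<lambda>y. poly p y * std_normal_density y) has_real_derivative
     - (poly (normal_adjoint p) y * std_normal_density y)) (at y)"
  by (auto intro!: derivative_eq_intros DERIV_mult[OF poly_DERIV std_normal_density_has_derivative, THEN DERIV_cong] simp: normal_adjoint_def algebra_simps)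

section \<open>An integral inequality for injective substitutions\<close>

text \<open>For a nonnegative integrand, the integral over the image of \<open>S\<close> is at most the integral over the
  whole line, so the image need not be computed.\<close>

lemma integral_change_of_variables_le:
  fixes g g' h :: "real \<Rightarrow> real"
  assumes h: "integrable lborel h" "\<And>y. 0 \<le> h y"
    and S: "S \<in> sets lebesgue"
    and deriv: "\<And>z. z \<in> S \<Longrightarrow> (g has_field_derivative g' z) (at z within S)"
    and inj: "inj_on g S"
  shows "(\<lambda>z. \<bar>g' z\<bar> * h (g z)) integrable_on S"
    and "integral S (\<lambda>z. \<bar>g' z\<bar> * h (g z)) \<le> (LBINT y. h y)"
proof -
  have "g differentiable_on S"
    unfolding differentiable_on_def using deriv
    by (meson has_field_derivative_imp_has_derivative differentiableI)
  then have img: "g ` S \<in> sets lebesgue"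
    using S by (intro differentiable_image_in_sets_lebesgue) auto
  have hU: "h absolutely_integrable_on UNIV"
    using h(1) by (simp add: set_integrable_def integrable_completion)
  then have hS: "h absolutely_integrable_on g ` S"
    using img by (rule set_integrable_subset) simp
  have cov: "(\<lambda>z. \<bar>g' z\<bar> * h (g z)) absolutely_integrable_on S \<and>
      integral S (\<lambda>z. \<bar>g' z\<bar> * h (g z)) = integral (g ` S) h"
    using has_absolute_integral_change_of_variables_1'[OF S deriv inj] hS by blast
  then show "(\<lambda>z. \<bar>g' z\<bar> * h (g z)) integrable_on S"
    using set_lebesgue_integral_eq_integral(1) by blast
  have "integral (g ` S) h \<le> integral UNIV h"
    using hU hS h(2) by (intro integral_subset_le) (auto intro: set_lebesgue_integral_eq_integral(1))
  also have "\<dots> = (LBINT y. h y)"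
    using h(1) by (metis integral_lborel)
  finally show "integral S (\<lambda>z. \<bar>g' z\<bar> * h (g z)) \<le> (LBINT y. h y)"
    using cov by simp
qed

section \<open>The similarity variable and Gaussian kernels\<close>

text \<open>Here \<open>s\<close> stands for \<open>\<sigma>\<^sub>t\<close>.\<close>
locale conga_parameters =
  fixes \<alpha> s :: real
  assumes alpha_pos: "0 < \<alpha>" and s_pos: "0 < s"
begin

definition similarity :: "real \<Rightarrow> real \<Rightarrow> real" where
  "similarity x z = (x - \<alpha> * z) / (s * sqrt z)"

text \<open>Up to the sign, this derivative in \<open>z\<close> is the algebraic factor of the Conga integrand, which makes
  it the Jacobian of the substitution.\<close>

definition similarity_slope :: "real \<Rightarrow> real \<Rightarrow> real" where
  "similarity_slope x z = - ((x + \<alpha> * z) / (2 * s * (z * sqrt z)))"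

text \<open>All derivatives of the Conga integrand are combinations of these kernels. For \<open>q > 0\<close> the convention
  \<open>1 / 0 = 0\<close> gives the value 0 at \<open>z = 0\<close>, which is the correct continuous extension for \<open>x > 0\<close>.\<close>

definition gauss_kernel :: "real poly \<Rightarrow> nat \<Rightarrow> real \<Rightarrow> real \<Rightarrow> real" where
  "gauss_kernel p q x z = (1 / sqrt z) ^ q * (poly p (similarity x z) * std_normal_density (similarity x z))"

lemma similarity_has_derivative:
  assumes "0 < z"
  shows "(similarity x has_real_derivative similarity_slope x z) (at z within S)"
proof -
  have "((\<lambda>z. (x - \<alpha> * z) / (s * sqrt z)) has_real_derivative
      ((- \<alpha>) * (s * sqrt z) - (x - \<alpha> * z) * (s * (inverse (sqrt z) / 2))) / (s * sqrt z * (s * sqrt z)))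
      (at z within S)"
    using assms s_pos by (auto intro!: derivative_eq_intros)
  also have "((- \<alpha>) * (s * sqrt z) - (x - \<alpha> * z) * (s * (inverse (sqrt z) / 2))) / (s * sqrt z * (s * sqrt z))
      = similarity_slope x z"
  proof -
    obtain r where r: "0 < r" "sqrt z = r" "z = r * r"
      using assms by (metis real_sqrt_gt_zero real_sqrt_mult_self abs_of_pos)
    show ?thesis
      using r(1) s_pos unfolding similarity_slope_def r(2) unfolding r(3) by (simp add: field_simps)
  qed
  finally show ?thesis by (simp add: similarity_def[abs_def])
qed

lemma inj_on_similarity:
  assumes "0 < x"
  shows "inj_on (similarity x) {0<..}"
proof (rule linorder_inj_onI)
  fix z z' :: real
  assume "z < z'" "z \<in> {0<..}"
  have "similarity x z' < similarity x z"
  proof (rule DERIV_neg_imp_decreasing[OF \<open>z < z'\<close>])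
    fix v assume "z \<le> v" "v \<le> z'"
    with \<open>z \<in> {0<..}\<close> have v: "0 < v" by simp
    then have "similarity_slope x v < 0"
      using assms alpha_pos s_pos by (simp add: similarity_slope_def add_pos_pos)
    then show "\<exists>d. DERIV (similarity x) v :> d \<and> d < 0"
      using similarity_has_derivative[OF v] by blast
  qed
  then show "similarity x z \<noteq> similarity x z'" by simp
qed auto

lemma gauss_kernel_at_0: "0 < q \<Longrightarrow> gauss_kernel p q x 0 = 0"
  by (simp add: gauss_kernel_def)

text \<open>The class of kernels is closed under \<open>\<partial>/\<partial>x\<close>, because \<open>\<partial>y/\<partial>x = 1 / (s \<surd>z)\<close> depends only on \<open>z\<close>.\<close>
lemma gauss_kernel_has_derivative:
  assumes "0 < q" "0 \<le> z"
  shows "((\<lambda>x. gauss_kernel p q x z) has_real_derivative - (gauss_kernel (normal_adjoint p) (Suc q) x z / s)) (at x within S)"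
proof (cases "z = 0")
  case True
  then show ?thesis using assms by (simp add: gauss_kernel_at_0)
next
  case False
  then have z: "0 < z" using assms by simp
  have y: "((\<lambda>x. similarity x z) has_real_derivative 1 / (s * sqrt z)) (at x within S)"
    using z s_pos unfolding similarity_def by (auto intro!: derivative_eq_intros simp: field_simps)
  have "((\<lambda>x. poly p (similarity x z) * std_normal_density (similarity x z)) has_real_derivative
      - (poly (normal_adjoint p) (similarity x z) * std_normal_density (similarity x z)) * (1 / (s * sqrt z))) (at x within S)"
    by (rule DERIV_chain2[OF normal_poly_has_derivative y])
  from DERIV_cmult[OF this, of "(1 / sqrt z) ^ q"] show ?thesis
    unfolding gauss_kernel_def by (rule DERIV_cong) simp
qed

text \<open>While \<open>x - \<alpha> z \<ge> a / 2\<close>, the factor \<open>1 / \<surd>z\<close> is at most a multiple of \<open>\<bar>y\<bar>\<close>. One spare power of it is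
  traded for \<open>\<surd>z\<close>, and the decay of the density absorbs the powers of \<open>y\<close>.\<close>

lemma gauss_kernel_le_sqrt:
  assumes "0 < q" "0 < a"
  obtains C where "\<And>x z. a < x \<Longrightarrow> 0 \<le> z \<Longrightarrow> z < a / (2 * \<alpha>) \<Longrightarrow> \<bar>gauss_kernel p q x z\<bar> \<le> C * sqrt z"
proof -
  obtain C where C: "\<And>y. \<bar>y\<bar> ^ Suc q * \<bar>poly p y\<bar> * std_normal_density y \<le> C"
    using normal_power_poly_bounded[of "Suc q" p] by blast
  have "\<bar>gauss_kernel p q x z\<bar> \<le> (2 * s / a) ^ Suc q * C * sqrt z"
    if xz: "a < x" "0 \<le> z" "z < a / (2 * \<alpha>)" for x z
  proof (cases "z = 0")
    case True
    then show ?thesis using assms by (simp add: gauss_kernel_at_0)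
  next
    case False
    then have z: "0 < sqrt z" using xz by simp
    let ?y = "similarity x z"
    have "a / 2 \<le> x - \<alpha> * z"
      using xz alpha_pos by (simp add: field_simps)
    then have "2 / a * (a / 2) \<le> 2 / a * (x - \<alpha> * z)"
      using assms(2) by (intro mult_left_mono) auto
    then have "1 / sqrt z \<le> 2 / a * (x - \<alpha> * z) / sqrt z"
      using z assms(2) by (intro divide_right_mono) auto
    also have "\<dots> = 2 * s / a * ?y"
      using s_pos by (simp add: similarity_def)
    also have "\<dots> \<le> 2 * s / a * \<bar>?y\<bar>"
      using s_pos assms(2) by (intro mult_left_mono) auto
    finally have "1 / sqrt z \<le> 2 * s / a * \<bar>?y\<bar>" .
    then have pow: "(1 / sqrt z) ^ Suc q \<le> (2 * s / a * \<bar>?y\<bar>) ^ Suc q"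
      using z by (intro power_mono) auto
    have "\<bar>gauss_kernel p q x z\<bar>
        = (1 / sqrt z) ^ Suc q * (\<bar>poly p ?y\<bar> * std_normal_density ?y) * sqrt z"
      using z by (simp add: gauss_kernel_def abs_mult power_abs)
    also have "\<dots> \<le> (2 * s / a * \<bar>?y\<bar>) ^ Suc q * (\<bar>poly p ?y\<bar> * std_normal_density ?y) * sqrt z"
      using z by (intro mult_right_mono pow) auto
    also have "\<dots> = (2 * s / a) ^ Suc q * (\<bar>?y\<bar> ^ Suc q * \<bar>poly p ?y\<bar> * std_normal_density ?y) * sqrt z"
      by (simp only: power_mult_distrib mult.assoc)
    also have "\<dots> \<le> (2 * s / a) ^ Suc q * C * sqrt z"
      using z s_pos assms(2) by (intro mult_right_mono mult_left_mono C) auto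
    finally show ?thesis .
  qed
  then show ?thesis using that by blast
qed

lemma continuous_on_gauss_kernel:
  assumes "0 < q"
  shows "continuous_on ({0<..} \<times> {0..}) (\<lambda>(x, z). gauss_kernel p q x z)"
proof (unfold continuous_on_eq_continuous_within, intro ballI)
  fix u :: "real \<times> real"
  assume u: "u \<in> {0<..} \<times> {0..}"
  obtain x0 z0 where u_eq: "u = (x0, z0)" by (cases u)
  with u have x0: "0 < x0" and z0: "0 \<le> z0" by auto
  show "continuous (at u within {0<..} \<times> {0..}) (\<lambda>(x, z). gauss_kernel p q x z)"
  proof (cases "z0 = 0")
    case False
    have "isCont (\<lambda>u. poly p (similarity (fst u) (snd u))) u"
      unfolding similarity_def using False z0 s_pos u_eq by (intro continuous_intros) auto
    then have "isCont (\<lambda>u. gauss_kernel p q (fst u) (snd u)) u"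
      unfolding gauss_kernel_def similarity_def std_normal_density_def
      using False z0 s_pos u_eq by (intro continuous_intros) auto
    then show ?thesis
      by (simp add: case_prod_unfold continuous_at_imp_continuous_at_within)
  next
    case True
    obtain C where C: "\<And>x z. x0 / 2 < x \<Longrightarrow> 0 \<le> z \<Longrightarrow> z < x0 / 2 / (2 * \<alpha>) \<Longrightarrow>
        \<bar>gauss_kernel p q x z\<bar> \<le> C * sqrt z"
      using gauss_kernel_le_sqrt[OF assms, of "x0 / 2"] x0 by auto
    have "\<forall>\<^sub>F v in at u within {0<..} \<times> {0..}. fst v > x0 / 2"
      by (rule order_tendstoD(1)[where y = x0]) (use x0 u_eq in \<open>auto intro!: tendsto_eq_intros\<close>)
    moreover have "\<forall>\<^sub>F v in at u within {0<..} \<times> {0..}. snd v < x0 / 2 / (2 * \<alpha>)"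
      by (rule order_tendstoD(2)[where y = 0])
        (use x0 alpha_pos u_eq True in \<open>auto intro!: tendsto_eq_intros\<close>)
    moreover have "\<forall>\<^sub>F v in at u within {0<..} \<times> {0..}. v \<in> {0<..} \<times> {0..}"
      by (simp add: eventually_at_filter)
    ultimately have "\<forall>\<^sub>F v in at u within {0<..} \<times> {0..}.
        norm (case v of (x, z) \<Rightarrow> gauss_kernel p q x z) \<le> C * sqrt (snd v)"
      by eventually_elim (auto intro!: C)
    moreover have "((\<lambda>v. C * sqrt (snd v)) \<longlongrightarrow> 0) (at u within {0<..} \<times> {0..})"
      by (auto intro!: tendsto_eq_intros simp: u_eq True)
    ultimately have "((\<lambda>(x, z). gauss_kernel p q x z) \<longlongrightarrow> 0) (at u within {0<..} \<times> {0..})"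
      by (rule Lim_null_comparison)
    then show ?thesis
      using assms by (simp add: continuous_within u_eq True gauss_kernel_at_0)
  qed
qed

section \<open>Differentiation under the integral\<close>

definition kernel_integral :: "(real \<Rightarrow> real) \<Rightarrow> real poly \<Rightarrow> nat \<Rightarrow> real \<Rightarrow> real" where
  "kernel_integral w p q x = integral {0..1} (\<lambda>z. w (1 - z) * gauss_kernel p q x z)"

lemma continuous_on_weighted_gauss_kernel:
  assumes "continuous_on {0..1} w" "0 < q"
  shows "continuous_on ({0<..} \<times> {0..1}) (\<lambda>(x, z). w (1 - z) * gauss_kernel p q x z)"
proof -
  have "continuous_on ({0<..} \<times> {0..1}) (\<lambda>u. w (1 - snd u))"
    by (rule continuous_on_compose2[OF assms(1)]) (auto intro!: continuous_intros)
  moreover have "continuous_on ({0<..} \<times> {0..1}) (\<lambda>(x, z). gauss_kernel p q x z)"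
    by (rule continuous_on_subset[OF continuous_on_gauss_kernel[OF assms(2)]]) auto
  ultimately show ?thesis
    unfolding case_prod_unfold by (rule continuous_on_mult)
qed

lemma continuous_on_weighted_gauss_kernel_slice:
  assumes "continuous_on {0..1} w" "0 < q" "0 < x"
  shows "continuous_on {0..1} (\<lambda>z. w (1 - z) * gauss_kernel p q x z)"
proof -
  have "continuous_on {0..1} (\<lambda>z. case (x, z) of (x, z) \<Rightarrow> w (1 - z) * gauss_kernel p q x z)"
    by (rule continuous_on_compose2[OF continuous_on_weighted_gauss_kernel[OF assms(1,2)]])
      (use assms(3) in \<open>auto intro!: continuous_intros\<close>)
  then show ?thesis by simp
qed

lemma kernel_integral_has_derivative:
  assumes w: "continuous_on {0..1} w" and "0 < q" "0 < x"
  shows "(kernel_integral w p q has_real_derivative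
    - (kernel_integral w (normal_adjoint p) (Suc q) x / s)) (at x)"
proof -
  let ?d = "\<lambda>x z. w (1 - z) * - (gauss_kernel (normal_adjoint p) (Suc q) x z / s)"
  have "((\<lambda>x. integral (cbox 0 1) (\<lambda>z. w (1 - z) * gauss_kernel p q x z))
      has_field_derivative integral (cbox 0 1) (?d x)) (at x within {0<..})"
  proof (rule leibniz_rule_field_derivative)
    show "((\<lambda>x. w (1 - z) * gauss_kernel p q x z) has_real_derivative ?d x z) (at x within {0<..})"
      if "z \<in> cbox 0 1" for x z
      using that assms(2) by (intro DERIV_cmult gauss_kernel_has_derivative) auto
    show "(\<lambda>z. w (1 - z) * gauss_kernel p q x z) integrable_on cbox 0 1" if "x \<in> {0<..}" for x
      using that continuous_on_weighted_gauss_kernel_slice[OF w assms(2)]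
      by (intro integrable_continuous) auto
    have "continuous_on ({0<..} \<times> {0..1})
        (\<lambda>u. - 1 / s * (case u of (x, z) \<Rightarrow> w (1 - z) * gauss_kernel (normal_adjoint p) (Suc q) x z))"
      by (intro continuous_intros continuous_on_weighted_gauss_kernel w) simp
    then show "continuous_on ({0<..} \<times> cbox 0 1) (\<lambda>(x, z). ?d x z)"
      by (simp add: case_prod_unfold)
  qed (use assms in auto)
  moreover have "integral (cbox 0 1) (?d x) = - (kernel_integral w (normal_adjoint p) (Suc q) x / s)"
    by (simp add: kernel_integral_def)
  moreover have "at x within {0<..} = at x"
    using assms(3) by (intro at_within_open) auto
  ultimately show ?thesis
    by (simp add: kernel_integral_def[abs_def])
qed

text \<open>The \<open>m\<close>-th derivative of the Conga line (lemma \<open>higher_deriv_conga_line\<close>). The equation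
  \<open>x + \<alpha> z = 2 \<alpha> z + s \<surd>z y\<close> removes \<open>x\<close> from the algebraic factor of the integrand, which leaves two
  kernels, with polynomials \<open>1 = He\<^sub>0\<close> and \<open>y = He\<^sub>1\<close>; each derivative raises both indices by one.\<close>

definition conga_deriv :: "(real \<Rightarrow> real) \<Rightarrow> nat \<Rightarrow> real \<Rightarrow> real" where
  "conga_deriv w m x = (- 1 / s) ^ m *
    (\<alpha> / s * kernel_integral w (hermite m) (Suc m) x
      + 1 / 2 * kernel_integral w (hermite (Suc m)) (Suc (Suc m)) x)"

lemma conga_kernel_eq:
  assumes "0 \<le> z"
  shows "1 / sqrt (2 * pi) * ((x + \<alpha> * z) / (2 * s * z powr (3/2))) *
      exp (- ((x - \<alpha> * z)\<^sup>2 / (2 * s\<^sup>2 * z)))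
    = \<alpha> / s * gauss_kernel (hermite 0) (Suc 0) x z + 1 / 2 * gauss_kernel (hermite (Suc 0)) (Suc (Suc 0)) x z"
proof (cases "z = 0")
  case True
  then show ?thesis by (simp add: gauss_kernel_at_0)
next
  case False
  then have z: "0 < z" using assms by simp
  define r where "r = sqrt z"
  have r: "0 < r" "z = r * r" using z by (simp_all add: r_def)
  have powr: "z powr (3/2) = r * r * r"
  proof -
    have "z powr (3/2) = z powr (1 + 1/2)" by simp
    also have "\<dots> = z * sqrt z" using z by (subst powr_add) (simp add: powr_half_sqrt)
    finally show ?thesis unfolding r_def[symmetric] unfolding r(2) by simp
  qed
  have y: "similarity x z = (x - \<alpha> * (r * r)) / (s * r)"
    unfolding similarity_def r_def[symmetric] unfolding r(2) ..
  have density: "std_normal_density (similarity x z)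
      = 1 / sqrt (2 * pi) * exp (- ((x - \<alpha> * z)\<^sup>2 / (2 * s\<^sup>2 * z)))"
    unfolding std_normal_density_def y
    by (simp add: r(2) power_divide power_mult_distrib power2_eq_square mult_ac)
  have "\<alpha> / s * gauss_kernel (hermite 0) (Suc 0) x z + 1 / 2 * gauss_kernel (hermite (Suc 0)) (Suc (Suc 0)) x z
      = (\<alpha> / (s * r) + similarity x z / (2 * (r * r))) * std_normal_density (similarity x z)"
    by (simp add: gauss_kernel_def normal_adjoint_def one_pCons pderiv_pCons algebra_simps flip: r_def)
  also have "\<alpha> / (s * r) + similarity x z / (2 * (r * r)) = (x + \<alpha> * z) / (2 * s * z powr (3/2))"
    unfolding y powr unfolding r(2) using r(1) s_pos by (simp add: field_simps)
  finally show ?thesis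
    unfolding density by (simp add: mult_ac)
qed

lemma conga_deriv_eq_integral:
  fixes m :: nat
  assumes "continuous_on {0..1} w" "0 < x"
  defines "F \<equiv> (\<lambda>z. w (1 - z) * (\<alpha> / s * gauss_kernel (hermite m) (Suc m) x z
      + 1 / 2 * gauss_kernel (hermite (Suc m)) (Suc (Suc m)) x z))"
  shows "continuous_on {0..1} F"
    and "conga_deriv w m x = (- 1 / s) ^ m * integral {0..1} F"
proof -
  let ?k = "\<lambda>p q z. w (1 - z) * gauss_kernel p q x z"
  have cont: "continuous_on {0..1} (?k p q)" if "0 < q" for p q
    using continuous_on_weighted_gauss_kernel_slice[OF assms(1) that assms(2)] .
  have F: "F = (\<lambda>z. \<alpha> / s * ?k (hermite m) (Suc m) z + 1 / 2 * ?k (hermite (Suc m)) (Suc (Suc m)) z)"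
    by (simp add: F_def fun_eq_iff algebra_simps)
  show "continuous_on {0..1} F"
    unfolding F by (intro continuous_on_add continuous_on_mult continuous_on_const cont) auto
  have int: "(\<lambda>z. c * ?k p q z) integrable_on {0..1}" if "0 < q" for c p q
    by (intro integrable_continuous_interval continuous_on_mult continuous_on_const cont that)
  show "conga_deriv w m x = (- 1 / s) ^ m * integral {0..1} F"
    unfolding F conga_deriv_def kernel_integral_def
    by (subst integral_add[OF int int]) simp_all
qed

lemma conga_deriv_has_derivative:
  assumes "continuous_on {0..1} w" "0 < x"
  shows "(conga_deriv w m has_real_derivative conga_deriv w (Suc m) x) (at x)"
proof -
  note d = kernel_integral_has_derivative[OF assms(1) zero_less_Suc assms(2)]
  show ?thesis
    unfolding conga_deriv_def[abs_def]
    by (rule DERIV_cong[OF DERIV_cmult[OF DERIV_add[OF DERIV_cmult[OF d] DERIV_cmult[OF d]]]])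
      (simp add: algebra_simps)
qed

section \<open>The bound for the derivatives\<close>

text \<open>The recursion \<open>He\<^sub>m\<^sub>+\<^sub>1 = y He\<^sub>m - m He\<^sub>m\<^sub>-\<^sub>1\<close> recombines the two kernels, since
  \<open>\<alpha> / (s \<surd>z) + y / (2 z) = \<bar>\<partial>y/\<partial>z\<bar>\<close>. The remaining term lacks this Jacobian, and the bound
  \<open>1 / (2 s z\<^sup>3\<^sup>/\<^sup>2) \<le> \<bar>\<partial>y/\<partial>z\<bar> / x\<close> restores it at the price of \<open>1 / x\<close>.\<close>

lemma kernel_majorant:
  assumes "0 < x" "0 < z"
  shows "\<bar>(- 1 / s) ^ Suc n * (\<alpha> / s * gauss_kernel (hermite (Suc n)) (Suc (Suc n)) x z
      + 1 / 2 * gauss_kernel (hermite (Suc (Suc n))) (Suc (Suc (Suc n))) x z)\<bar>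
    \<le> \<bar>similarity_slope x z\<bar> * (std_normal_density (similarity x z) *
        ((1 / (s * sqrt z)) ^ Suc n * \<bar>poly (hermite (Suc n)) (similarity x z)\<bar>
          + real (Suc n) / x * ((1 / (s * sqrt z)) ^ n * \<bar>poly (hermite n) (similarity x z)\<bar>)))"
    (is "?lhs \<le> _")
proof -
  define r where "r = sqrt z"
  have r: "0 < r" "z = r * r" using assms by (simp_all add: r_def)
  define b where "b = 1 / (s * r)"
  have b: "0 < b" using r s_pos by (simp add: b_def)
  define y where "y = similarity x z"
  define \<phi> where "\<phi> = std_normal_density y"
  define H where "H = poly (hermite (Suc n)) y"
  define H' where "H' = poly (hermite n) y"
  define v where "v = \<bar>similarity_slope x z\<bar>"
  have y: "y = (x - \<alpha> * (r * r)) / (s * r)"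
    unfolding y_def similarity_def r_def[symmetric] unfolding r(2) ..
  have v_eq: "v = (x + \<alpha> * (r * r)) / (2 * s * (r * r * r))"
    using assms alpha_pos s_pos r unfolding v_def similarity_slope_def r_def[symmetric] unfolding r(2)
    by (simp add: abs_divide abs_mult)
  have v_split: "v = \<alpha> / (s * r) + y / (2 * (r * r))"
    unfolding v_eq y using r(1) s_pos by (simp add: field_simps)
  have v_ge: "1 / (2 * s * (r * r * r)) \<le> v / x"
    unfolding v_eq using assms alpha_pos s_pos r(1) by (simp add: field_simps)
  have rec: "poly (hermite (Suc (Suc n))) y = y * H - real (Suc n) * H'"
    unfolding hermite.simps(2)[of "Suc n"] normal_adjoint_def[of "hermite (Suc n)"] pderiv_hermite
    by (simp add: H_def H'_def del: hermite.simps)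
  have "?lhs = \<bar>(1 / s) ^ Suc n * (\<alpha> / s * ((1 / r) ^ Suc (Suc n) * (H * \<phi>))
      + 1 / 2 * ((1 / r) ^ Suc (Suc (Suc n)) * ((y * H - real (Suc n) * H') * \<phi>)))\<bar>"
    unfolding gauss_kernel_def y_def[symmetric] r_def[symmetric] \<phi>_def[symmetric] rec H_def[symmetric]
    using s_pos by (simp add: abs_mult power_abs abs_divide)
  also have "(1 / s) ^ Suc n * (\<alpha> / s * ((1 / r) ^ Suc (Suc n) * (H * \<phi>))
      + 1 / 2 * ((1 / r) ^ Suc (Suc (Suc n)) * ((y * H - real (Suc n) * H') * \<phi>)))
    = \<phi> * (b ^ Suc n * H * (\<alpha> / (s * r) + y / (2 * (r * r)))
        - b ^ n * (real (Suc n) * H') * (1 / (2 * s * (r * r * r))))"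
    unfolding b_def using r(1) s_pos by (simp add: power_divide power_mult_distrib field_simps)
  also have "\<dots> = \<phi> * (b ^ Suc n * H * v - b ^ n * (real (Suc n) * H') * (1 / (2 * s * (r * r * r))))"
    by (simp only: v_split)
  also have "\<bar>\<dots>\<bar> \<le> \<phi> * (b ^ Suc n * \<bar>H\<bar> * v + b ^ n * (real (Suc n) * \<bar>H'\<bar>) * (1 / (2 * s * (r * r * r))))"
  proof -
    have "\<bar>b ^ Suc n * H * v - b ^ n * (real (Suc n) * H') * (1 / (2 * s * (r * r * r)))\<bar>
        \<le> \<bar>b ^ Suc n * H * v\<bar> + \<bar>b ^ n * (real (Suc n) * H') * (1 / (2 * s * (r * r * r)))\<bar>"
      by (rule abs_triangle_ineq4)
    also have "\<dots> = b ^ Suc n * \<bar>H\<bar> * v + b ^ n * (real (Suc n) * \<bar>H'\<bar>) * (1 / (2 * s * (r * r * r)))"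
      using b s_pos r(1) by (simp add: abs_mult v_def)
    finally show ?thesis
      by (simp add: abs_mult \<phi>_def mult_left_mono)
  qed
  also have "\<dots> \<le> \<phi> * (b ^ Suc n * \<bar>H\<bar> * v + b ^ n * (real (Suc n) * \<bar>H'\<bar>) * (v / x))"
    using b by (intro mult_left_mono add_left_mono v_ge) (auto simp: \<phi>_def)
  also have "\<dots> = v * (\<phi> * (b ^ Suc n * \<bar>H\<bar> + real (Suc n) / x * (b ^ n * \<bar>H'\<bar>)))"
    by (simp add: algebra_simps add_divide_distrib)
  finally show ?thesis
    unfolding v_def \<phi>_def b_def H_def H'_def y_def r_def .
qed

text \<open>The first term is a bound for \<open>z \<le> \<epsilon>\<close> and the second one for \<open>z > \<epsilon>\<close>. Their sum is a bound for
  every \<open>z\<close>, so that the integral is never split at \<open>\<epsilon>\<close>, which may exceed 1.\<close>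

lemma inverse_scale_power_le:
  assumes "0 < x" "0 < z" "0 < \<epsilon>" "\<alpha> * \<epsilon> < x"
  shows "(1 / (s * sqrt z)) ^ k
    \<le> (1 / (x - \<alpha> * \<epsilon>)) ^ k * \<bar>similarity x z\<bar> ^ k + (1 / (s * sqrt \<epsilon>)) ^ k"
proof (cases "z \<le> \<epsilon>")
  case True
  then have le: "x - \<alpha> * \<epsilon> \<le> x - \<alpha> * z" using alpha_pos by simp
  have "1 / (s * sqrt z) \<le> (x - \<alpha> * z) / (x - \<alpha> * \<epsilon>) * (1 / (s * sqrt z))"
    using le assms s_pos mult_right_mono[of 1 "(x - \<alpha> * z) / (x - \<alpha> * \<epsilon>)" "1 / (s * sqrt z)"] by simp
  also have "\<dots> \<le> 1 / (x - \<alpha> * \<epsilon>) * \<bar>similarity x z\<bar>"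
    using le assms s_pos by (simp add: similarity_def)
  finally have "(1 / (s * sqrt z)) ^ k \<le> (1 / (x - \<alpha> * \<epsilon>) * \<bar>similarity x z\<bar>) ^ k"
    using assms s_pos by (intro power_mono) auto
  moreover have "0 \<le> (1 / (s * sqrt \<epsilon>)) ^ k" using assms s_pos by simp
  ultimately show ?thesis unfolding power_mult_distrib by linarith
next
  case False
  then have "1 / (s * sqrt z) \<le> 1 / (s * sqrt \<epsilon>)"
    using assms s_pos by (intro divide_left_mono mult_left_mono) auto
  then have "(1 / (s * sqrt z)) ^ k \<le> (1 / (s * sqrt \<epsilon>)) ^ k"
    using assms s_pos by (intro power_mono) auto
  moreover have "0 \<le> (1 / (x - \<alpha> * \<epsilon>)) ^ k * \<bar>similarity x z\<bar> ^ k" using assms by simp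
  ultimately show ?thesis by linarith
qed

text \<open>Both regimes of \<open>z\<close> are integrated over the whole \<open>y\<close>-line at once. The four terms are the Gaussian
  means of \<open>\<bar>y\<^sup>k He\<^sub>k\<bar>\<close> and \<open>\<bar>He\<^sub>k\<bar>\<close> for \<open>k = n + 1\<close> and \<open>k = n\<close>.\<close>

lemma conga_deriv_bound:
  assumes w: "continuous_on {0..1} w" and N: "\<And>r. r \<in> {0..1} \<Longrightarrow> \<bar>w r\<bar> \<le> N"
    and x: "0 < x" and eps: "0 < \<epsilon>" "\<alpha> * \<epsilon> < x"
  defines "a \<equiv> 1 / (x - \<alpha> * \<epsilon>)" and "b \<equiv> 1 / (s * sqrt \<epsilon>)"
  shows "\<bar>conga_deriv w (Suc n) x\<bar> \<le> N *
    (a ^ Suc n * (sqrt 2 ^ Suc n * fact (Suc n)) + b ^ Suc n * sqrt (fact (Suc n))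
      + real (Suc n) / x * (a ^ n * (sqrt 2 ^ n * fact n) + b ^ n * sqrt (fact n)))"
proof -
  have ab: "0 < a" "0 < b" using eps s_pos by (simp_all add: a_def b_def)
  have N0: "0 \<le> N" using N[of 0] by force
  define A where "A = (\<lambda>k y. std_normal_density y * (\<bar>y\<bar> ^ k * \<bar>poly (hermite k) y\<bar>))"
  define B where "B = (\<lambda>k y. std_normal_density y * \<bar>poly (hermite k) y\<bar>)"
  have int_A: "integrable lborel (A k)" for k
    using integrable_normal_abs_poly[of "monom 1 k * hermite k"]
    by (simp add: A_def poly_monom abs_mult power_abs)
  have int_B: "integrable lborel (B k)" for k
    unfolding B_def by (rule integrable_normal_abs_poly)
  define h where "h = (\<lambda>y. a ^ Suc n * A (Suc n) y + b ^ Suc n * B (Suc n) y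
      + real (Suc n) / x * (a ^ n * A n y + b ^ n * B n y))"
  have int_h: "integrable lborel h"
    unfolding h_def
    by (intro Bochner_Integration.integrable_add integrable_mult_right int_A int_B)
  have h_nonneg: "0 \<le> h y" for y
    using ab x unfolding h_def A_def B_def by (intro add_nonneg_nonneg mult_nonneg_nonneg) auto
  have "(LBINT y. h y) = a ^ Suc n * (LBINT y. A (Suc n) y) + b ^ Suc n * (LBINT y. B (Suc n) y)
      + real (Suc n) / x * (a ^ n * (LBINT y. A n y) + b ^ n * (LBINT y. B n y))"
    unfolding h_def using int_A int_B
    by (simp del: power_Suc of_nat_Suc)
  also have "\<dots> \<le> a ^ Suc n * (sqrt 2 ^ Suc n * fact (Suc n)) + b ^ Suc n * sqrt (fact (Suc n))
      + real (Suc n) / x * (a ^ n * (sqrt 2 ^ n * fact n) + b ^ n * sqrt (fact n))"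
    using ab x unfolding A_def B_def
    by (intro add_mono mult_left_mono normal_mean_abs_power_hermite_le normal_mean_abs_hermite_le) auto
  finally have h_le: "(LBINT y. h y) \<le> \<dots>" .
  define F where "F = (\<lambda>z. w (1 - z) * (\<alpha> / s * gauss_kernel (hermite (Suc n)) (Suc (Suc n)) x z
      + 1 / 2 * gauss_kernel (hermite (Suc (Suc n))) (Suc (Suc (Suc n))) x z))"
  have F: "continuous_on {0..1} F" "conga_deriv w (Suc n) x = (- 1 / s) ^ Suc n * integral {0..1} F"
    unfolding F_def by (rule conga_deriv_eq_integral[OF w x])+
  \<comment> \<open>The substitution is singular at \<open>z = 0\<close>, so this null set is removed first.\<close>
  have null: "negligible {z \<in> {0..1} - {0<..1::real}. P z}" "negligible {z \<in> {0<..1::real} - {0..1}. P z}" for P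
    by (rule negligible_subset[of "{0}"]; auto)+
  have FS: "F integrable_on {0<..1}" "integral {0..1} F = integral {0<..1} F"
    using integrable_spike_set[OF integrable_continuous_interval[OF F(1)] null] integral_spike_set[OF null]
    by blast+
  have bound: "norm ((- 1 / s) ^ Suc n * F z) \<le> N * (\<bar>similarity_slope x z\<bar> * h (similarity x z))" if "z \<in> {0<..1}" for z
  proof -
    let ?y = "similarity x z" and ?c = "1 / (s * sqrt z)"
    have z: "0 < z" "1 - z \<in> {0..1}" using that by auto
    have c: "?c ^ k * \<bar>poly (hermite k) ?y\<bar> \<le> (a ^ k * \<bar>?y\<bar> ^ k + b ^ k) * \<bar>poly (hermite k) ?y\<bar>" for k
      unfolding a_def b_def by (intro mult_right_mono inverse_scale_power_le x z eps) simp
    have "norm ((- 1 / s) ^ Suc n * F z) \<le> N * (\<bar>similarity_slope x z\<bar> * (std_normal_density ?y *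
        (?c ^ Suc n * \<bar>poly (hermite (Suc n)) ?y\<bar> + real (Suc n) / x * (?c ^ n * \<bar>poly (hermite n) ?y\<bar>))))"
      unfolding F_def mult.left_commute[of _ "w (1 - z)"] real_norm_def abs_mult[of "w (1 - z)"]
      by (intro mult_mono N z kernel_majorant x N0) simp
    also have "\<dots> \<le> N * (\<bar>similarity_slope x z\<bar> * (std_normal_density ?y *
        ((a ^ Suc n * \<bar>?y\<bar> ^ Suc n + b ^ Suc n) * \<bar>poly (hermite (Suc n)) ?y\<bar>
          + real (Suc n) / x * ((a ^ n * \<bar>?y\<bar> ^ n + b ^ n) * \<bar>poly (hermite n) ?y\<bar>))))"
      using x by (intro mult_left_mono add_mono c N0) auto
    also have "\<dots> = N * (\<bar>similarity_slope x z\<bar> * h ?y)"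
      by (simp add: h_def A_def B_def algebra_simps del: power_Suc of_nat_Suc hermite.simps)
    finally show ?thesis .
  qed
  have S: "{0<..1::real} \<in> sets lebesgue" by simp
  have inj: "inj_on (similarity x) {0<..1}"
    by (rule inj_on_subset[OF inj_on_similarity[OF x]]) auto
  have deriv: "(similarity x has_field_derivative similarity_slope x z) (at z within {0<..1})" if "z \<in> {0<..1}" for z
    using that by (intro similarity_has_derivative) auto
  note cov = integral_change_of_variables_le[OF int_h h_nonneg S deriv inj]
  have "\<bar>conga_deriv w (Suc n) x\<bar> = norm (integral {0<..1} (\<lambda>z. (- 1 / s) ^ Suc n * F z))"
    unfolding F(2) FS(2) by simp
  also have "\<dots> \<le> integral {0<..1} (\<lambda>z. N * (\<bar>similarity_slope x z\<bar> * h (similarity x z)))"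
    by (intro integral_norm_bound_integral bound integrable_on_mult_right FS cov(1))
  also have "\<dots> \<le> N * (LBINT y. h y)"
    using cov(2) N0 by (simp add: mult_left_mono)
  also have "\<dots> \<le> N * (a ^ Suc n * (sqrt 2 ^ Suc n * fact (Suc n)) + b ^ Suc n * sqrt (fact (Suc n))
      + real (Suc n) / x * (a ^ n * (sqrt 2 ^ n * fact n) + b ^ n * sqrt (fact n)))"
    using h_le N0 by (rule mult_left_mono)
  finally show ?thesis .
qed

section \<open>Derivatives of the Conga line\<close>

lemma conga_line_eq_conga_deriv_0:
  assumes w: "continuous_on {0..1} w" and x: "0 < x" and s: "s = conga_sigma \<alpha> t"
  shows "conga_line \<alpha> t w x = conga_deriv w 0 x"
proof -
  let ?F = "\<lambda>z. w (1 - z) * (\<alpha> / s * gauss_kernel (hermite 0) (Suc 0) x z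
      + 1 / 2 * gauss_kernel (hermite (Suc 0)) (Suc (Suc 0)) x z)"
  note F = conga_deriv_eq_integral[OF w x, of 0]
  have "conga_line \<alpha> t w x = (LBINT z:{0..1}. ?F z)"
    unfolding conga_line_def s[symmetric]
  proof (rule set_lebesgue_integral_cong; (intro allI impI)?)
    fix z :: real
    assume "z \<in> {0..1}"
    then have z: "0 \<le> z" by simp
    show "w (1 - z) * (1 / sqrt (2 * pi)) * ((x + \<alpha> * z) / (2 * s * z powr (3/2))) *
        exp (- ((x - \<alpha> * z)\<^sup>2 / (2 * s\<^sup>2 * z))) = ?F z"
      unfolding conga_kernel_eq[OF z, symmetric] by (simp only: mult.assoc)
  qed simp
  also have "\<dots> = integral {0..1} ?F"
    by (rule set_borel_integral_eq_integral(2)[OF borel_integrable_atLeastAtMost'[OF F(1)]])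
  finally show ?thesis using F(2) by simp
qed

lemma higher_deriv_conga_line:
  assumes w: "continuous_on {0..1} w" and s: "s = conga_sigma \<alpha> t" and "0 < x"
  shows "(deriv ^^ m) (conga_line \<alpha> t w) x = conga_deriv w m x"
    and "((deriv ^^ m) (conga_line \<alpha> t w) has_real_derivative conga_deriv w (Suc m) x) (at x)"
proof -
  have eq: "(deriv ^^ m) (conga_line \<alpha> t w) y = conga_deriv w m y" if "0 < y" for m y
    using that
  proof (induction m arbitrary: y)
    case 0
    then show ?case using conga_line_eq_conga_deriv_0[OF w _ s] by simp
  next
    case (Suc m)
    have "((deriv ^^ m) (conga_line \<alpha> t w) has_real_derivative conga_deriv w (Suc m) y) (at y)"
      by (rule has_field_derivative_transform_within_open
          [OF conga_deriv_has_derivative[OF w Suc.prems] open_greaterThan])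
        (use Suc in auto)
    then show ?case by (simp add: DERIV_imp_deriv)
  qed
  show "(deriv ^^ m) (conga_line \<alpha> t w) x = conga_deriv w m x"
    by (rule eq[OF assms(3)])
  show "((deriv ^^ m) (conga_line \<alpha> t w) has_real_derivative conga_deriv w (Suc m) x) (at x)"
    by (rule has_field_derivative_transform_within_open
        [OF conga_deriv_has_derivative[OF w assms(3)] open_greaterThan])
      (use assms(3) eq in auto)
qed

end

lemma abs_le_path_norm:
  assumes "continuous_on {0..1} w" "r \<in> {0..1}"
  shows "\<bar>w r\<bar> \<le> path_norm w"
proof -
  have "compact ((\<lambda>s. \<bar>w s\<bar>) ` {0..1})"
    by (intro compact_continuous_image continuous_intros assms(1)) simp
  then show ?thesis
    unfolding path_norm_def using assms(2)
    by (intro cSUP_upper) (auto intro: bounded_imp_bdd_above compact_imp_bounded)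
qed

theorem lemma3:
  fixes M :: "'a measure" and W :: "real \<Rightarrow> 'a \<Rightarrow> real" and \<omega> :: 'a
    and \<alpha> t x \<epsilon> :: real and n :: nat
  defines "w \<equiv> (\<lambda>s. W s \<omega>)"
  assumes "0 < \<alpha>" "\<alpha> < 1"
    and "standard_brownian_motion_01 M W" and "\<omega> \<in> space M"
    and "0 < t" and "0 < x" "x \<le> 1" and "0 < \<epsilon>" "\<epsilon> < x / \<alpha>"
  shows "(\<forall>k\<le>n. \<forall>\<^sub>F y in nhds x. (deriv ^^ k) (conga_line \<alpha> t w) differentiable at y) \<and>
    \<bar>(deriv ^^ (n + 1)) (conga_line \<alpha> t w) x\<bar> \<le>
      (2 * pi) powr (1/4) * path_norm w *
        ((sqrt 2 / (x - \<alpha> * \<epsilon>)) ^ (n + 1) + 1 / x * (sqrt 2 / (x - \<alpha> * \<epsilon>)) ^ n) * fact (n + 1)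
      + path_norm w *
        ((1 / (conga_sigma \<alpha> t * sqrt \<epsilon>)) ^ (n + 1)
          + real (n + 1) / x * (1 / (conga_sigma \<alpha> t * sqrt \<epsilon>)) ^ n) * sqrt (fact (n + 1))"
proof -
  have w: "continuous_on {0..1} w"
    unfolding w_def by (rule standard_brownian_motion_01.continuous_paths[OF assms(4,5)])
  have s: "0 < conga_sigma \<alpha> t"
    using assms by (simp add: conga_sigma_def)
  interpret conga_parameters \<alpha> "conga_sigma \<alpha> t"
    using assms s by unfold_locales
  have eps: "\<alpha> * \<epsilon> < x" using assms by (simp add: field_simps)
  have N: "\<bar>w r\<bar> \<le> path_norm w" if "r \<in> {0..1}" for r
    using abs_le_path_norm[OF w that] .
  have N0: "0 \<le> path_norm w" using N[of 0] by force
  have differentiable: "\<forall>\<^sub>F y in nhds x. (deriv ^^ k) (conga_line \<alpha> t w) differentiable at y" for k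
  proof -
    have "\<forall>\<^sub>F y in nhds x. 0 < y"
      by (rule order_tendstoD(1)[OF filterlim_ident \<open>0 < x\<close>])
    then show ?thesis
      unfolding real_differentiable_def
      by eventually_elim (use higher_deriv_conga_line(2)[OF w refl] in blast)
  qed
  define a where "a = 1 / (x - \<alpha> * \<epsilon>)"
  define b where "b = 1 / (conga_sigma \<alpha> t * sqrt \<epsilon>)"
  define P where "P = (sqrt 2 * a) ^ (n + 1) + 1 / x * (sqrt 2 * a) ^ n"
  have ab: "0 < a" "0 < b" using eps s \<open>0 < \<epsilon>\<close> by (simp_all add: a_def b_def)
  have P0: "0 \<le> P" using ab \<open>0 < x\<close> by (simp add: P_def)
  have "\<bar>(deriv ^^ (n + 1)) (conga_line \<alpha> t w) x\<bar> = \<bar>conga_deriv w (Suc n) x\<bar>"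
    using higher_deriv_conga_line(1)[OF w refl \<open>0 < x\<close>, of "Suc n"] by simp
  also have "\<dots> \<le> path_norm w *
    (a ^ Suc n * (sqrt 2 ^ Suc n * fact (Suc n)) + b ^ Suc n * sqrt (fact (Suc n))
      + real (Suc n) / x * (a ^ n * (sqrt 2 ^ n * fact n) + b ^ n * sqrt (fact n)))"
    unfolding a_def b_def by (rule conga_deriv_bound[OF w N \<open>0 < x\<close> \<open>0 < \<epsilon>\<close> eps])
  also have "\<dots> = path_norm w * (P * fact (n + 1)
      + (b ^ Suc n * sqrt (fact (Suc n)) + real (Suc n) / x * (b ^ n * sqrt (fact n))))"
    by (simp add: P_def power_mult_distrib algebra_simps add_divide_distrib)
  \<comment> \<open>The stated bound is weaker: \<open>(2 \<pi>)\<^sup>1\<^sup>/\<^sup>4 \<ge> 1\<close> and \<open>n! \<le> (n + 1)!\<close>.\<close>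
  also have "\<dots> \<le> path_norm w * ((2 * pi) powr (1/4) * (P * fact (n + 1))
      + (b ^ Suc n * sqrt (fact (Suc n)) + real (Suc n) / x * (b ^ n * sqrt (fact (Suc n)))))"
  proof (intro mult_left_mono add_mono N0 order_refl)
    have "1 \<le> (2 * pi) powr (1/4)"
      using pi_gt3 by (intro ge_one_powr_ge_zero) auto
    then show "P * fact (n + 1) \<le> (2 * pi) powr (1/4) * (P * fact (n + 1))"
      using P0 mult_right_mono[of 1 "(2 * pi) powr (1/4)" "P * fact (n + 1)"]
      by (simp del: fact_Suc)
    show "sqrt (fact n) \<le> sqrt (fact (Suc n))"
      by (intro real_sqrt_le_mono fact_mono) simp
  qed (use ab \<open>0 < x\<close> in auto)
  also have "\<dots> = (2 * pi) powr (1/4) * path_norm w * P * fact (n + 1)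
      + path_norm w * (b ^ (n + 1) + real (n + 1) / x * b ^ n) * sqrt (fact (n + 1))"
    by (simp add: algebra_simps)
  finally show ?thesis
    using differentiable by (simp add: P_def a_def b_def)
qed

end
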